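(* Let $(N,v)$ be a multiple partners matching game defined on some triple $(G,b,w)$. For every maximum weight $b$-matching $M^*$ of $G$ and every core allocation $x$ of $(N,v)$, we can find in polynomial time a payoff vector $p$ compatible with $M^*$ such that $x=p^t$.
   Context: Here $G=(N,E)$ is a finite undirected graph without loops or multiple edges, $b:N\to\mathbb{Z}_{\ge 0}$ is a vertex capacity function, and $w:E\to\mathbb{R}_{\ge 0}$ is an edge weighting. A set $M\subseteq E$ is a $b$-matching if every $i\in N$ is incident to at most $b(i)$ edges of $M$; its weight is $w(M)=\sum_{e\in M}w(e)$. A function $p:N\times N\to\mathbb{R}_{\ge 0}$ (nonnegative) is a payoff vector compatible with $M$ if $p(i,j)+p(j,i)=w(ij)$ for all $ij\in M$ and $p(i,j)=p(j,i)=0$ for all $ij\notin M$. The total payoff vector $p^t\in\mathbb{R}^N$ is $p^t(i)=\sum_{j:ij\in E}p(i,j)$. The multiple partners matching game $(N,v)$ defined on $(G,b,w)$ is the cooperative game in which, for $S\subseteq N$, $v(S)$ is the maximum weight of a $b$-matching in the induced subgraph $G[S]$ (and $0$ if $G[S]$ is edgeless). A core allocation is a vector $x\in\mathbb{R}^N$ with $\sum_{i\in N}x(i)=v(N)$ and $\sum_{i\in S}x(i)\ge v(S)$ for all nonempty $S\subseteq N$. *)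

theory Defs
  imports Complex_Main "HOL-Computational_Algebra.Polynomial"
begin

section \<open>Matching games with multiple partners\<close>

text \<open>An edge between \<open>i\<close> and \<open>j\<close> is the two-element set \<open>{i, j}\<close>.\<close>

definition weighted_graph :: "'a set \<Rightarrow> 'a set set \<Rightarrow> ('a set \<Rightarrow> real) \<Rightarrow> bool" where
  "weighted_graph N E w \<longleftrightarrow>
     finite N \<and> (\<forall>e\<in>E. e \<subseteq> N \<and> card e = 2) \<and> (\<forall>e\<in>E. 0 \<le> w e)"

definition b_matching :: "'a set \<Rightarrow> 'a set set \<Rightarrow> ('a \<Rightarrow> nat) \<Rightarrow> 'a set set \<Rightarrow> bool" where
  "b_matching N E b M \<longleftrightarrow> M \<subseteq> E \<and> (\<forall>i\<in>N. card {e \<in> M. i \<in> e} \<le> b i)"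

definition weight :: "('a set \<Rightarrow> real) \<Rightarrow> 'a set set \<Rightarrow> real" where
  "weight w M = (\<Sum>e\<in>M. w e)"

definition max_weight_b_matching ::
    "'a set \<Rightarrow> 'a set set \<Rightarrow> ('a \<Rightarrow> nat) \<Rightarrow> ('a set \<Rightarrow> real) \<Rightarrow> 'a set set \<Rightarrow> bool" where
  "max_weight_b_matching N E b w M \<longleftrightarrow>
     b_matching N E b M \<and> (\<forall>M'. b_matching N E b M' \<longrightarrow> weight w M' \<le> weight w M)"

definition induced_edges :: "'a set set \<Rightarrow> 'a set \<Rightarrow> 'a set set" where
  "induced_edges E S = {e \<in> E. e \<subseteq> S}"

text \<open>If no edge lies inside \<open>S\<close>, the empty set is the only \<open>b\<close>-matching and the value is \<open>0\<close>.\<close>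

definition game_value :: "'a set set \<Rightarrow> ('a \<Rightarrow> nat) \<Rightarrow> ('a set \<Rightarrow> real) \<Rightarrow> 'a set \<Rightarrow> real" where
  "game_value E b w S = Max {weight w M |M. b_matching S (induced_edges E S) b M}"

text \<open>Vectors indexed by \<open>N\<close> are functions whose values outside \<open>N\<close> are irrelevant.\<close>

definition core_allocation :: "'a set \<Rightarrow> ('a set \<Rightarrow> real) \<Rightarrow> ('a \<Rightarrow> real) \<Rightarrow> bool" where
  "core_allocation N v x \<longleftrightarrow>
     (\<Sum>i\<in>N. x i) = v N \<and> (\<forall>S. S \<subseteq> N \<and> S \<noteq> {} \<longrightarrow> v S \<le> (\<Sum>i\<in>S. x i))"

definition compatible_payoff ::
    "'a set \<Rightarrow> ('a set \<Rightarrow> real) \<Rightarrow> 'a set set \<Rightarrow> ('a \<Rightarrow> 'a \<Rightarrow> real) \<Rightarrow> bool" where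
  "compatible_payoff N w M p \<longleftrightarrow>
     (\<forall>i\<in>N. \<forall>j\<in>N. 0 \<le> p i j \<and>
        ({i, j} \<in> M \<longrightarrow> p i j + p j i = w {i, j}) \<and>
        ({i, j} \<notin> M \<longrightarrow> p i j = 0 \<and> p j i = 0))"

definition total_payoff :: "'a set \<Rightarrow> 'a set set \<Rightarrow> ('a \<Rightarrow> 'a \<Rightarrow> real) \<Rightarrow> 'a \<Rightarrow> real" where
  "total_payoff N E p i = (\<Sum>j \<in> {j \<in> N. {i, j} \<in> E}. p i j)"

section \<open>Algorithms on real data\<close>

text \<open>
  Since weights and allocations are real, running time is measured on a unit-cost real RAM,
  presented as a while language over two-dimensional arrays of naturals and of reals.
  A scalar is the entry at index \<open>(0, 0)\<close>.

  The arithmetic is restricted to addition, subtraction (truncated on naturals), comparison and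
  fixed constants. Without multiplication, the bit length of a number grows by at most a
  constant per step, up to a fixed factor depending on the program, so unit cost does not hide
  expensive operations: on rational data polynomially many steps also mean polynomial time
  on a Turing machine.
\<close>

datatype iexp =
    IConst nat
  | IGet string iexp iexp
  | IAdd iexp iexp
  | ISub iexp iexp

datatype rexp =
    RConst rat
  | RGet string iexp iexp
  | RAdd rexp rexp
  | RSub rexp rexp

datatype test =
    ILess iexp iexp
  | RLess rexp rexp
  | Neg test
  | Conj test test

datatype com =
    Skip
  | ISet string iexp iexp iexp
  | RSet string iexp iexp rexp
  | Seq com com
  | Cond test com com
  | Loop test com

type_synonym 'v store = "string \<Rightarrow> nat \<Rightarrow> nat \<Rightarrow> 'v"
type_synonym state = "nat store \<times> real store"

definition store_update :: "'v store \<Rightarrow> string \<Rightarrow> nat \<Rightarrow> nat \<Rightarrow> 'v \<Rightarrow> 'v store" where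
  "store_update m a k l v = m(a := (m a)(k := (m a k)(l := v)))"

primrec ival :: "iexp \<Rightarrow> state \<Rightarrow> nat" where
  "ival (IConst c) s = c"
| "ival (IGet a e f) s = fst s a (ival e s) (ival f s)"
| "ival (IAdd e f) s = ival e s + ival f s"
| "ival (ISub e f) s = ival e s - ival f s"

primrec rval :: "rexp \<Rightarrow> state \<Rightarrow> real" where
  "rval (RConst c) s = of_rat c"
| "rval (RGet a e f) s = snd s a (ival e s) (ival f s)"
| "rval (RAdd e f) s = rval e s + rval f s"
| "rval (RSub e f) s = rval e s - rval f s"

primrec holds :: "test \<Rightarrow> state \<Rightarrow> bool" where
  "holds (ILess e f) s \<longleftrightarrow> ival e s < ival f s"
| "holds (RLess e f) s \<longleftrightarrow> rval e s < rval f s"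
| "holds (Neg c) s \<longleftrightarrow> \<not> holds c s"
| "holds (Conj c d) s \<longleftrightarrow> holds c s \<and> holds d s"

text \<open>
  \<open>exec c s t s'\<close>: started in \<open>s\<close>, the program \<open>c\<close> terminates in \<open>s'\<close> after \<open>t\<close> steps. Each
  assignment and each evaluation of a test is one step; the expressions in a fixed program
  have bounded size.
\<close>

inductive exec :: "com \<Rightarrow> state \<Rightarrow> nat \<Rightarrow> state \<Rightarrow> bool" where
  Skip: "exec Skip s 1 s"
| ISet: "exec (ISet a e f g) s 1
           (store_update (fst s) a (ival e s) (ival f s) (ival g s), snd s)"
| RSet: "exec (RSet a e f g) s 1
           (fst s, store_update (snd s) a (ival e s) (ival f s) (rval g s))"
| Seq: "exec c s t s' \<Longrightarrow> exec d s' t' s'' \<Longrightarrow> exec (Seq c d) s (t + t') s''"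
| CondTrue: "holds e s \<Longrightarrow> exec c s t s' \<Longrightarrow> exec (Cond e c d) s (Suc t) s'"
| CondFalse: "\<not> holds e s \<Longrightarrow> exec d s t s' \<Longrightarrow> exec (Cond e c d) s (Suc t) s'"
| LoopTrue: "holds e s \<Longrightarrow> exec c s t s' \<Longrightarrow> exec (Loop e c) s' t' s'' \<Longrightarrow>
           exec (Loop e c) s (Suc (t + t')) s''"
| LoopFalse: "\<not> holds e s \<Longrightarrow> exec (Loop e c) s 1 s"

inductive_cases exec_SeqE: "exec (Seq c d) s t s'"
inductive_cases exec_CondE: "exec (Cond e c d) s t s'"
inductive_cases exec_LoopE: "exec (Loop e c) s t s'"
inductive_cases exec_SkipE: "exec Skip s t s'"
inductive_cases exec_ISetE: "exec (ISet a e f g) s t s'"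
inductive_cases exec_RSetE: "exec (RSet a e f g) s t s'"

lemma exec_deterministic:
  "exec c s t s' \<Longrightarrow> exec c s u s'' \<Longrightarrow> u = t \<and> s'' = s'"
proof (induction arbitrary: u s'' rule: exec.induct)
  case (Seq c s t s' d t' r)
  from Seq.prems show ?case by (rule exec_SeqE) (metis Seq.IH)
next
  case (CondTrue e s c t s' d)
  from CondTrue.prems show ?case by (rule exec_CondE) (metis CondTrue)+
next
  case (CondFalse e s d t s' c)
  from CondFalse.prems show ?case by (rule exec_CondE) (metis CondFalse)+
next
  case (LoopTrue e s c t s' t' r)
  from LoopTrue.prems show ?case by (rule exec_LoopE) (metis LoopTrue)+
next
  case (LoopFalse e s c)
  from LoopFalse.prems show ?case by (rule exec_LoopE) (simp_all add: LoopFalse)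
qed (erule exec_SkipE exec_ISetE exec_RSetE, simp)+

text \<open>
  The list \<open>vs\<close> enumerates the vertices. The graph and the \<open>b\<close>-matching are given by adjacency
  matrices and all unused cells are \<open>0\<close>, so an instance with \<open>n\<close> vertices occupies a
  number of cells that is quadratic in \<open>n\<close>.
\<close>

definition input_state ::
    "'a list \<Rightarrow> 'a set set \<Rightarrow> ('a \<Rightarrow> nat) \<Rightarrow> ('a set \<Rightarrow> real) \<Rightarrow> 'a set set \<Rightarrow> ('a \<Rightarrow> real) \<Rightarrow> state"
  where
  "input_state vs E b w M x =
    (\<lambda>a k l.
       if a = ''n'' \<and> k = 0 \<and> l = 0 then length vs
       else if a = ''edge'' \<and> k < length vs \<and> l < length vs \<and> {vs ! k, vs ! l} \<in> E then 1
       else if a = ''matching'' \<and> k < length vs \<and> l < length vs \<and> {vs ! k, vs ! l} \<in> M then 1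
       else if a = ''capacity'' \<and> k < length vs \<and> l = 0 then b (vs ! k)
       else 0,
     \<lambda>a k l.
       if a = ''weight'' \<and> k < length vs \<and> l < length vs \<and> {vs ! k, vs ! l} \<in> E
         then w {vs ! k, vs ! l}
       else if a = ''allocation'' \<and> k < length vs \<and> l = 0 then x (vs ! k)
       else 0)"

definition outputs_payoff :: "'a list \<Rightarrow> state \<Rightarrow> ('a \<Rightarrow> 'a \<Rightarrow> real) \<Rightarrow> bool" where
  "outputs_payoff vs s p \<longleftrightarrow>
     (\<forall>k < length vs. \<forall>l < length vs. snd s ''payoff'' k l = p (vs ! k) (vs ! l))"

end

theory Submission
  imports Defs
begin

text \<open>
  Each edge of the matching may be split arbitrarily between its ends, so the payoffs form a
  transportation problem. By Hall's condition it is solvable as soon as every \<open>S\<close> demands at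
  least the weight of the matching edges inside \<open>S\<close>, and this is what the core inequality for
  \<open>S\<close> gives, since these edges form a \<open>b\<close>-matching of the subgraph induced by \<open>S\<close>.

  The solution is computed by push-relabel. A pass visits the vertices by decreasing label,
  pushes excess along admissible arcs, and increments the label of a vertex that keeps positive
  excess. A pass without relabelling removes all positive excess, because pushes only reach
  vertices visited later. The core condition bounds all labels by \<open>n\<close>, hence their sum by
  \<open>n\<^sup>2\<close>, so \<open>(n + 1) n\<close> passes suffice.
\<close>

section \<open>Transport on a symmetric weight matrix\<close>

text \<open>Ordered double sums meet every edge twice, hence the factors 2.
  \<open>total_demand\<close> reverses \<open>subset_demand\<close> for the whole set, so supply and
  demand balance.\<close>

locale transport =
  fixes n :: nat and W :: "nat \<Rightarrow> nat \<Rightarrow> real" and x :: "nat \<Rightarrow> real"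
  assumes W_nonneg: "\<lbrakk>i < n; j < n\<rbrakk> \<Longrightarrow> 0 \<le> W i j"
    and W_sym: "\<lbrakk>i < n; j < n\<rbrakk> \<Longrightarrow> W i j = W j i"
    and W_diag: "i < n \<Longrightarrow> W i i = 0"
    and subset_demand: "S \<subseteq> {..<n} \<Longrightarrow> (\<Sum>i\<in>S. \<Sum>j\<in>S. W i j) \<le> 2 * sum x S"
    and total_demand: "2 * sum x {..<n} \<le> (\<Sum>i<n. \<Sum>j<n. W i j)"
begin

text \<open>Here \<open>e\<close> is the excess of total payoff over demand; the transportation
  problem is solved when it vanishes.\<close>

definition payoff_inv :: "(nat \<Rightarrow> nat \<Rightarrow> real) \<Rightarrow> (nat \<Rightarrow> real) \<Rightarrow> bool" where
  "payoff_inv p e \<longleftrightarrow>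
     (\<forall>i<n. \<forall>j<n. 0 \<le> p i j \<and> p i j + p j i = W i j) \<and>
     (\<forall>i<n. e i = (\<Sum>j<n. p i j) - x i)"

text \<open>Moving payoff from \<open>p i j\<close> to \<open>p j i\<close> carries excess from
  \<open>i\<close> to \<open>j\<close>, so \<open>p i j\<close> is the residual capacity of that
  arc. As in push-relabel for flows, labels drop by at most one along residual arcs, and a vertex in
  deficit still has label 0.\<close>

definition label_inv :: "(nat \<Rightarrow> nat \<Rightarrow> real) \<Rightarrow> (nat \<Rightarrow> real) \<Rightarrow> (nat \<Rightarrow> nat) \<Rightarrow> bool" where
  "label_inv p e d \<longleftrightarrow>
     (\<forall>i<n. \<forall>j<n. 0 < p i j \<longrightarrow> d i \<le> Suc (d j)) \<and>
     (\<forall>i<n. 0 < d i \<longrightarrow> 0 \<le> e i) \<and> (\<forall>i<n. d i \<le> n)"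

text \<open>
  In pass \<open>K\<close>, while vertex \<open>u\<close> of level \<open>n - l\<close> is processed: unless the labels have grown,
  no vertex processed so far has positive excess.
\<close>

definition progress :: "nat \<Rightarrow> nat \<Rightarrow> nat \<Rightarrow> (nat \<Rightarrow> real) \<Rightarrow> (nat \<Rightarrow> nat) \<Rightarrow> bool" where
  "progress K l u e d \<longleftrightarrow>
     K < sum d {..<n} \<or> (\<forall>k<n. e k \<le> 0) \<or>
     (K \<le> sum d {..<n} \<and> (\<forall>k<n. n < d k + l \<or> d k + l = n \<and> k < u \<longrightarrow> e k \<le> 0))"

text \<open>The label sum counts relabellings: after \<open>K\<close> passes there were at least
  \<open>K\<close> of them, or no positive excess is left.\<close>

definition settled :: "nat \<Rightarrow> (nat \<Rightarrow> real) \<Rightarrow> (nat \<Rightarrow> nat) \<Rightarrow> bool" where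
  "settled K e d \<longleftrightarrow> K \<le> sum d {..<n} \<or> (\<forall>k<n. e k \<le> 0)"

section \<open>Excess of closed vertex sets and the bound on labels\<close>

lemma double_sum_payoff:
  assumes "payoff_inv p e" "S \<subseteq> {..<n}"
  shows "2 * (\<Sum>i\<in>S. \<Sum>j\<in>S. p i j) = (\<Sum>i\<in>S. \<Sum>j\<in>S. W i j)"
proof -
  have "(\<Sum>i\<in>S. \<Sum>j\<in>S. W i j) = (\<Sum>i\<in>S. \<Sum>j\<in>S. p i j + p j i)"
    using assms unfolding payoff_inv_def by (intro sum.cong refl) (metis lessThan_iff subsetD)
  also have "\<dots> = (\<Sum>i\<in>S. \<Sum>j\<in>S. p i j) + (\<Sum>i\<in>S. \<Sum>j\<in>S. p j i)"
    by (simp add: sum.distrib)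
  also have "(\<Sum>i\<in>S. \<Sum>j\<in>S. p j i) = (\<Sum>i\<in>S. \<Sum>j\<in>S. p i j)"
    by (rule sum.swap)
  finally show ?thesis by simp
qed

text \<open>No payoff leaves \<open>S\<close>, so its members receive exactly the weight inside
  \<open>S\<close>, however it is split, and \<open>subset_demand\<close> bounds that by their
  demand.\<close>

lemma excess_closed_set:
  assumes inv: "payoff_inv p e" and S: "S \<subseteq> {..<n}"
    and closed: "\<And>i j. i \<in> S \<Longrightarrow> j < n \<Longrightarrow> j \<notin> S \<Longrightarrow> p i j \<le> 0"
  shows "sum e S \<le> 0"
proof -
  have "(\<Sum>j<n. p i j) = (\<Sum>j\<in>S. p i j)" if "i \<in> S" for i
    using that inv S closed unfolding payoff_inv_def
    by (intro sum.mono_neutral_right) (auto intro!: antisym)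
  then have "e i = (\<Sum>j\<in>S. p i j) - x i" if "i \<in> S" for i
    using that inv S unfolding payoff_inv_def by auto
  then have "sum e S = (\<Sum>i\<in>S. \<Sum>j\<in>S. p i j) - sum x S"
    by (simp add: sum_subtractf)
  then show ?thesis
    using double_sum_payoff[OF inv S] subset_demand[OF S] by simp
qed

text \<open>
  If \<open>n \<le> d u\<close>, some label \<open>g < n\<close> is not attained, no payoff can be shifted out of the set of
  vertices with larger labels, and its excess is positive, against the core condition.
\<close>

lemma label_less_if_excess:
  assumes inv: "payoff_inv p e" "label_inv p e d" and u: "u < n" "0 < e u"
  shows "d u < n"
proof (rule ccontr)
  assume "\<not> d u < n"
  then have du: "n \<le> d u" by simp
  have "\<not> {..<n} \<subseteq> d ` ({..<n} - {u})"
  proof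
    assume "{..<n} \<subseteq> d ` ({..<n} - {u})"
    then have "card {..<n} \<le> card (d ` ({..<n} - {u}))"
      by (intro card_mono) auto
    also have "\<dots> \<le> card ({..<n} - {u})" by (intro card_image_le) auto
    also have "\<dots> < card {..<n}" using u by (intro card_Diff1_less) auto
    finally show False by simp
  qed
  then obtain g where g: "g < n" "g \<notin> d ` ({..<n} - {u})" by auto
  define S where "S = {k. k < n \<and> g < d k}"
  have "sum e S \<le> 0"
  proof (rule excess_closed_set[OF inv(1)])
    fix i j assume *: "i \<in> S" "j < n" "j \<notin> S"
    \<comment> \<open>The unattained \<open>g\<close> leaves a gap: labels in \<open>S\<close>
      exceed it and labels outside are below it. A residual arc cannot drop by two.\<close>
    then have "d j \<noteq> g" using g du by (metis DiffI image_eqI lessThan_iff not_less singletonD)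
    with * have "\<not> d i \<le> Suc (d j)" by (auto simp: S_def)
    then show "p i j \<le> 0" using inv(2) * unfolding label_inv_def S_def by force
  qed (auto simp: S_def)
  moreover have "0 < sum e S"
  proof (rule sum_pos2)
    show "0 \<le> e i" if "i \<in> S" for i
      using that inv(2) unfolding label_inv_def S_def by auto
  qed (use u g du in \<open>auto simp: S_def\<close>)
  ultimately show False by simp
qed

section \<open>Pushing and relabelling preserve the invariants\<close>

definition push :: "(nat \<Rightarrow> nat \<Rightarrow> real) \<Rightarrow> nat \<Rightarrow> nat \<Rightarrow> real \<Rightarrow> nat \<Rightarrow> nat \<Rightarrow> real" where
  "push p u v \<delta> = (\<lambda>i j. p i j - (if i = u \<and> j = v then \<delta> else 0) + (if i = v \<and> j = u then \<delta> else 0))"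

definition push_excess :: "(nat \<Rightarrow> real) \<Rightarrow> nat \<Rightarrow> nat \<Rightarrow> real \<Rightarrow> nat \<Rightarrow> real" where
  "push_excess e u v \<delta> = (\<lambda>i. e i - (if i = u then \<delta> else 0) + (if i = v then \<delta> else 0))"

lemma push_payoff_inv:
  assumes "payoff_inv p e" "u < n" "v < n" "u \<noteq> v" "0 \<le> \<delta>" "\<delta> \<le> p u v"
  shows "payoff_inv (push p u v \<delta>) (push_excess e u v \<delta>)"
proof -
  have "(\<Sum>j<n. push p u v \<delta> i j) =
      (\<Sum>j<n. p i j) - (if i = u then \<delta> else 0) + (if i = v then \<delta> else 0)" for i
    using assms by (cases "i = u"; cases "i = v")
      (simp_all add: push_def sum.distrib sum_subtractf)
  moreover have "0 \<le> push p u v \<delta> i j \<and> push p u v \<delta> i j + push p u v \<delta> j i = W i j"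
    if "i < n" "j < n" for i j
    using assms that unfolding payoff_inv_def push_def by auto
  ultimately show ?thesis
    using assms unfolding payoff_inv_def push_excess_def by simp
qed

text \<open>The only arc a push can make residual is the reverse one from \<open>v\<close> to
  \<open>u\<close>, and there the label rises. The cap \<open>\<delta> \<le> e u\<close> keeps
  \<open>u\<close> out of deficit.\<close>

lemma push_label_inv:
  assumes "label_inv p e d" "u < n" "v < n" "d u = Suc (d v)" "0 \<le> \<delta>" "\<delta> \<le> e u"
  shows "label_inv (push p u v \<delta>) (push_excess e u v \<delta>) d"
proof -
  have "d i \<le> Suc (d j)" if "i < n" "j < n" "0 < push p u v \<delta> i j" for i j
  proof (cases "i = v \<and> j = u")
    case True
    then show ?thesis using assms by simp
  next
    case False
    then have "0 < p i j" using that assms by (auto simp: push_def split: if_splits)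
    then show ?thesis using assms that unfolding label_inv_def by blast
  qed
  then show ?thesis
    using assms unfolding label_inv_def push_excess_def by auto
qed

text \<open>The receiver \<open>v\<close> is one level below the current one, hence not yet visited,
  and visited vertices keep their excess.\<close>

lemma push_progress:
  assumes "progress K l u e d" "u < n" "d u + l = n" "d u = Suc (d v)" "0 \<le> \<delta>" "0 < e u"
  shows "progress K l u (push_excess e u v \<delta>) d"
proof -
  have "e k \<le> 0 \<Longrightarrow> push_excess e u v \<delta> k \<le> 0" if "n < d k + l \<or> d k + l = n \<and> k < u" for k
    using that assms unfolding push_excess_def by auto
  then show ?thesis using assms unfolding progress_def by (meson not_less)
qed

text \<open>Saturation excludes residual arcs from \<open>u\<close> that drop by exactly one, which
  makes room for the increment; \<open>label_less_if_excess\<close> keeps the new label at most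
  \<open>n\<close>. Positive excess at \<open>u\<close> forces \<open>K \<le> sum d {..<n}\<close>,
  and the increment makes this strict.\<close>

lemma relabel:
  assumes inv: "payoff_inv p e" "label_inv p e d" and u: "u < n" "0 < e u"
    and saturated: "\<And>v. v < n \<Longrightarrow> d u = Suc (d v) \<Longrightarrow> p u v \<le> 0"
    and prog: "progress K l u e d"
  shows "label_inv p e (d(u := Suc (d u)))" "progress K l (Suc u) e (d(u := Suc (d u)))"
proof -
  have "Suc (d u) \<le> Suc (d j)" if "j < n" "0 < p u j" for j
    using that inv(2) u saturated[of j] unfolding label_inv_def
    by (metis le_Suc_eq not_less Suc_le_mono)
  moreover have "d i \<le> Suc (Suc (d u))" if "i < n" "0 < p i u" for i
    using that inv(2) u unfolding label_inv_def by (meson le_Suc_eq)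
  ultimately show "label_inv p e (d(u := Suc (d u)))"
    using inv(2) u label_less_if_excess[OF inv u] unfolding label_inv_def by auto
  have "sum (d(u := Suc (d u))) {..<n} = Suc (sum d {..<n})"
    using u by (simp add: sum.remove[of "{..<n}" u])
  moreover have "K \<le> sum d {..<n}" using prog u unfolding progress_def by force
  ultimately show "progress K l (Suc u) e (d(u := Suc (d u)))"
    unfolding progress_def by simp
qed

section \<open>The course of a pass and termination\<close>

lemma progress_next_vertex:
  "progress K l u e d \<Longrightarrow> d u + l \<noteq> n \<or> e u \<le> 0 \<Longrightarrow> progress K l (Suc u) e d"
  unfolding progress_def less_Suc_eq by blast

lemma progress_next_level: "progress K l n e d \<Longrightarrow> progress K (Suc l) 0 e d"
  unfolding progress_def by (auto simp: not_less less_Suc_eq)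

text \<open>Labels never exceed \<open>n\<close>, so for \<open>l = 0\<close> and
  \<open>u = 0\<close> no vertex counts as visited.\<close>

lemma progress_start: "label_inv p e d \<Longrightarrow> settled K e d \<Longrightarrow> progress K 0 0 e d"
  unfolding progress_def settled_def label_inv_def by force

text \<open>At \<open>l = Suc n\<close> even label 0 satisfies \<open>n < d k + l\<close>, so every
  vertex counts as visited.\<close>

lemma progress_end: "progress K (Suc n) 0 e d \<Longrightarrow> settled (Suc K) e d"
  unfolding progress_def settled_def by auto

text \<open>The label sum is at most \<open>n * n\<close>, which is below \<open>Suc n * n\<close>,
  so no positive excess is left. By \<open>total_demand\<close> the excesses have a nonnegative sum,
  hence all vanish.\<close>

lemma excess_eq_0:
  assumes inv: "payoff_inv p e" "label_inv p e d" and "settled (Suc n * n) e d" "i < n"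
  shows "e i = 0"
proof -
  have "sum d {..<n} \<le> of_nat (card {..<n}) * n"
    by (intro sum_bounded_above) (use inv(2) in \<open>auto simp: label_inv_def\<close>)
  then have nonpos: "\<forall>k<n. e k \<le> 0"
    using assms unfolding settled_def by auto
  have "sum e {..<n} = (\<Sum>i<n. \<Sum>j<n. p i j) - sum x {..<n}"
    using inv(1) unfolding payoff_inv_def by (simp add: sum_subtractf)
  then have "0 \<le> sum e {..<n}"
    using double_sum_payoff[OF inv(1), of "{..<n}"] total_demand by simp
  then have "sum (\<lambda>k. - e k) {..<n} = 0"
    using nonpos by (intro antisym) (auto simp: sum_negf intro!: sum_nonpos)
  then have "\<forall>k\<in>{..<n}. - e k = 0"
    using nonpos by (subst (asm) sum_nonneg_eq_0_iff) auto
  then show ?thesis using \<open>i < n\<close> by auto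
qed

text \<open>Each edge goes wholly to its end of smaller index. Any split is a valid start, since
  zero labels satisfy \<open>label_inv\<close>.\<close>

definition initial_payoff :: "nat \<Rightarrow> nat \<Rightarrow> real" where
  "initial_payoff i j = (if i < j then W i j else 0)"

lemma initial_inv:
  assumes "\<And>i j. i < n \<Longrightarrow> j < n \<Longrightarrow> p i j = initial_payoff i j"
    and "\<And>i. i < n \<Longrightarrow> e i = (\<Sum>j<n. initial_payoff i j) - x i"
    and "\<And>i. d i = 0"
  shows "payoff_inv p e" "label_inv p e d" "settled 0 e d"
proof -
  have "initial_payoff i j + initial_payoff j i = W i j" if "i < n" "j < n" for i j
    using that W_sym[of i j] W_diag[of i] by (auto simp: initial_payoff_def)
  then show "payoff_inv p e"
    using assms W_nonneg unfolding payoff_inv_def by (auto simp: initial_payoff_def)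
qed (simp_all add: assms label_inv_def settled_def)

end

section \<open>Programs with a time bound\<close>

text \<open>\<open>T\<close> is an upper bound, so branches of different cost can share it.
  Exhibiting one run gives total correctness because \<open>exec\<close> is deterministic.\<close>

definition wp :: "com \<Rightarrow> nat \<Rightarrow> (state \<Rightarrow> bool) \<Rightarrow> state \<Rightarrow> bool" where
  "wp c T Q s \<longleftrightarrow> (\<exists>t s'. exec c s t s' \<and> t \<le> T \<and> Q s')"

lemma wp_mono: "wp c T Q s \<Longrightarrow> (\<And>s. Q s \<Longrightarrow> R s) \<Longrightarrow> wp c T R s"
  unfolding wp_def by blast

lemma wp_Skip: "Q s \<Longrightarrow> wp Skip 1 Q s"
  unfolding wp_def using exec.Skip by blast

lemma wp_ISet:
  "Q (store_update (fst s) a (ival e s) (ival f s) (ival g s), snd s) \<Longrightarrow> wp (ISet a e f g) 1 Q s"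
  unfolding wp_def using exec.ISet by blast

lemma wp_RSet:
  "Q (fst s, store_update (snd s) a (ival e s) (ival f s) (rval g s)) \<Longrightarrow> wp (RSet a e f g) 1 Q s"
  unfolding wp_def using exec.RSet by blast

lemma wp_Seq: "wp c T (wp d U Q) s \<Longrightarrow> wp (Seq c d) (T + U) Q s"
  unfolding wp_def using exec.Seq by (meson add_mono)

lemma wp_Cond:
  assumes "holds e s \<Longrightarrow> wp c T Q s" and "\<not> holds e s \<Longrightarrow> wp d U Q s"
  shows "wp (Cond e c d) (Suc (T + U)) Q s"
proof (cases "holds e s")
  case True
  then show ?thesis
    using assms exec.CondTrue unfolding wp_def by (meson Suc_le_mono trans_le_add1)
next
  case False
  then show ?thesis
    using assms exec.CondFalse unfolding wp_def by (meson Suc_le_mono trans_le_add2)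
qed

abbreviation IVar :: "string \<Rightarrow> iexp" where
  "IVar a \<equiv> IGet a (IConst 0) (IConst 0)"

abbreviation set_var :: "string \<Rightarrow> nat \<Rightarrow> state \<Rightarrow> state" where
  "set_var a k s \<equiv> (store_update (fst s) a 0 0 k, snd s)"

definition For :: "string \<Rightarrow> iexp \<Rightarrow> com \<Rightarrow> com" where
  "For a e c = Seq (ISet a (IConst 0) (IConst 0) (IConst 0))
     (Loop (ILess (IVar a) e)
       (Seq c (ISet a (IConst 0) (IConst 0) (IAdd (IVar a) (IConst 1)))))"

text \<open>Each iteration pays 2 for test and increment; the other 2 are the initial assignment and
  the last test. By \<open>frame\<close> the invariant ignores the counter cell, and its index
  \<open>k\<close> carries the count.\<close>

lemma wp_For:
  assumes bound: "\<And>k s. I k s \<Longrightarrow> ival e s = m"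
    and frame: "\<And>k s j. I k s \<Longrightarrow> I k (set_var a j s)"
    and body: "\<And>k s. k < m \<Longrightarrow> I k s \<Longrightarrow> fst s a 0 0 = k \<Longrightarrow>
      wp c T (\<lambda>s'. I (Suc k) s' \<and> fst s' a 0 0 = k) s"
    and init: "I 0 s"
  shows "wp (For a e c) (m * (T + 2) + 2) (I m) s"
proof -
  let ?loop = "Loop (ILess (IVar a) e)
       (Seq c (ISet a (IConst 0) (IConst 0) (IAdd (IVar a) (IConst 1))))"
  have loop: "wp ?loop ((m - k) * (T + 2) + 1) (I m) s"
    if "k \<le> m" "I k s" "fst s a 0 0 = k" for k s
    using that
  proof (induction "m - k" arbitrary: k s)
    case 0
    then have "\<not> holds (ILess (IVar a) e) s" using bound by simp
    from exec.LoopFalse[OF this] have "exec ?loop s 1 s" .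
    moreover have "k = m" using 0 by simp
    ultimately show ?case
      using 0 unfolding wp_def by (intro exI[of _ 1] exI[of _ s]) simp
  next
    case (Suc j)
    then have "k < m" by simp
    have test: "holds (ILess (IVar a) e) s" using bound Suc by simp
    obtain t s1 where 1: "exec c s t s1" "t \<le> T" "I (Suc k) s1" "fst s1 a 0 0 = k"
      using body[OF \<open>k < m\<close> Suc.prems(2,3)] unfolding wp_def by blast
    have 2: "exec (ISet a (IConst 0) (IConst 0) (IAdd (IVar a) (IConst 1))) s1 1 (set_var a (Suc k) s1)"
      using exec.ISet[of a "IConst 0" "IConst 0" "IAdd (IVar a) (IConst 1)" s1] 1(4) by simp
    have "wp ?loop ((m - Suc k) * (T + 2) + 1) (I m) (set_var a (Suc k) s1)"
      using Suc.hyps \<open>k < m\<close> frame[OF 1(3)] by (intro Suc.hyps(1)) (auto simp: store_update_def)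
    then obtain t' s2 where 3: "exec ?loop (set_var a (Suc k) s1) t' s2"
      "t' \<le> (m - Suc k) * (T + 2) + 1" "I m s2"
      unfolding wp_def by blast
    have "exec ?loop s (Suc (t + 1 + t')) s2"
      using exec.LoopTrue[OF test exec.Seq[OF 1(1) 2] 3(1)] .
    moreover have "m - k = Suc (m - Suc k)" using \<open>k < m\<close> by simp
    ultimately show ?case
      unfolding wp_def using 1(2) 3(2,3) by (intro exI[of _ "Suc (t + 1 + t')"] exI[of _ s2]) simp
  qed
  have "wp (For a e c) (1 + (m * (T + 2) + 1)) (I m) s"
    unfolding For_def
    using loop[of 0] frame[OF init, of 0]
    by (intro wp_Seq wp_ISet) (simp add: store_update_def)
  then show ?thesis by (simp add: add.commute)
qed

section \<open>The push-relabel program\<close>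

abbreviation R2 :: "string \<Rightarrow> string \<Rightarrow> string \<Rightarrow> rexp" where
  "R2 a i j \<equiv> RGet a (IVar i) (IVar j)"

abbreviation R1 :: "string \<Rightarrow> string \<Rightarrow> rexp" where
  "R1 a i \<equiv> RGet a (IVar i) (IConst 0)"

abbreviation R0 :: "string \<Rightarrow> rexp" where
  "R0 a \<equiv> RGet a (IConst 0) (IConst 0)"

abbreviation label_of :: "string \<Rightarrow> iexp" where
  "label_of i \<equiv> IGet ''label'' (IVar i) (IConst 0)"

abbreviation IEq :: "iexp \<Rightarrow> iexp \<Rightarrow> test" where
  "IEq e f \<equiv> Conj (Neg (ILess e f)) (Neg (ILess f e))"

text \<open>Payoff cells start at 0, already the initial value elsewhere, so only matched entries
  above the diagonal are written.\<close>

definition init_entry :: com where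
  "init_entry = Cond (Conj (ILess (IVar ''u'') (IVar ''v''))
         (ILess (IConst 0) (IGet ''matching'' (IVar ''u'') (IVar ''v''))))
       (Seq (RSet ''payoff'' (IVar ''u'') (IVar ''v'') (R2 ''weight'' ''u'' ''v''))
         (RSet ''excess'' (IVar ''u'') (IConst 0)
           (RAdd (R1 ''excess'' ''u'') (R2 ''weight'' ''u'' ''v''))))
       Skip"

definition init_prog :: com where
  "init_prog = For ''u'' (IVar ''n'')
     (Seq (RSet ''excess'' (IVar ''u'') (IConst 0) (RSub (RConst 0) (R1 ''allocation'' ''u'')))
       (For ''v'' (IVar ''n'') init_entry))"

text \<open>The test ignores residual capacity: on a saturated arc the pushed amount is 0 and
  nothing changes.\<close>

definition push_prog :: com where
  "push_prog = Cond (Conj (IEq (label_of ''u'') (IAdd (label_of ''v'') (IConst 1)))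
         (RLess (RConst 0) (R1 ''excess'' ''u'')))
       (Seq (RSet ''delta'' (IConst 0) (IConst 0) (R1 ''excess'' ''u''))
       (Seq (Cond (RLess (R2 ''payoff'' ''u'' ''v'') (R0 ''delta''))
              (RSet ''delta'' (IConst 0) (IConst 0) (R2 ''payoff'' ''u'' ''v'')) Skip)
       (Seq (RSet ''payoff'' (IVar ''u'') (IVar ''v'') (RSub (R2 ''payoff'' ''u'' ''v'') (R0 ''delta'')))
       (Seq (RSet ''payoff'' (IVar ''v'') (IVar ''u'') (RAdd (R2 ''payoff'' ''v'' ''u'') (R0 ''delta'')))
       (Seq (RSet ''excess'' (IVar ''u'') (IConst 0) (RSub (R1 ''excess'' ''u'') (R0 ''delta'')))
         (RSet ''excess'' (IVar ''v'') (IConst 0) (RAdd (R1 ''excess'' ''v'') (R0 ''delta''))))))))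
       Skip"

definition relabel_prog :: com where
  "relabel_prog = Cond (RLess (RConst 0) (R1 ''excess'' ''u''))
     (ISet ''label'' (IVar ''u'') (IConst 0) (IAdd (label_of ''u'') (IConst 1))) Skip"

text \<open>As \<open>l\<close> counts upward, this meets labels in decreasing order. A relabelled
  vertex rises above the current level and is not visited again in the pass.\<close>

definition vertex_prog :: com where
  "vertex_prog = Cond (IEq (IAdd (label_of ''u'') (IVar ''l'')) (IVar ''n''))
     (Seq (For ''v'' (IVar ''n'') push_prog) relabel_prog) Skip"

definition pass_prog :: com where
  "pass_prog = For ''l'' (IAdd (IVar ''n'') (IConst 1)) (For ''u'' (IVar ''n'') vertex_prog)"

text \<open>Expressions have no product, so two nested loops realise the \<open>Suc n * n\<close>
  passes.\<close>

definition main_prog :: com where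
  "main_prog = For ''i'' (IAdd (IVar ''n'') (IConst 1)) (For ''j'' (IVar ''n'') pass_prog)"

abbreviation payoff :: "state \<Rightarrow> nat \<Rightarrow> nat \<Rightarrow> real" where
  "payoff s \<equiv> snd s ''payoff''"

abbreviation excess :: "state \<Rightarrow> nat \<Rightarrow> real" where
  "excess s \<equiv> \<lambda>k. snd s ''excess'' k 0"

abbreviation label :: "state \<Rightarrow> nat \<Rightarrow> nat" where
  "label s \<equiv> \<lambda>k. fst s ''label'' k 0"

section \<open>Correctness and running time of the main loops\<close>

context transport
begin

definition main_inv :: "state \<Rightarrow> bool" where
  "main_inv s \<longleftrightarrow> fst s ''n'' 0 0 = n \<and> payoff_inv (payoff s) (excess s) \<and>
     label_inv (payoff s) (excess s) (label s)"

definition vars :: "nat \<Rightarrow> nat \<Rightarrow> nat \<Rightarrow> nat \<Rightarrow> state \<Rightarrow> bool" where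
  "vars i j l u s \<longleftrightarrow> fst s ''i'' 0 0 = i \<and> fst s ''j'' 0 0 = j \<and> fst s ''l'' 0 0 = l \<and> fst s ''u'' 0 0 = u"

text \<open>By the last conjunct no admissible arc scanned so far allows a further nonzero push; at
  \<open>v = n\<close> and with positive excess it is the premise \<open>saturated\<close> of
  \<open>relabel\<close>.\<close>

definition push_inv :: "nat \<Rightarrow> nat \<Rightarrow> nat \<Rightarrow> nat \<Rightarrow> nat \<Rightarrow> nat \<Rightarrow> state \<Rightarrow> bool" where
  "push_inv K i j l u v s \<longleftrightarrow> main_inv s \<and> vars i j l u s \<and> progress K l u (excess s) (label s) \<and>
     label s u + l = n \<and>
     (\<forall>v'<v. label s u = Suc (label s v') \<longrightarrow> excess s u \<le> 0 \<or> payoff s u v' \<le> 0)"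

lemma wp_push_prog:
  assumes inv: "push_inv K i j l u v s" and v: "fst s ''v'' 0 0 = v" "v < n" and u: "u < n"
  shows "wp push_prog 10 (\<lambda>s. push_inv K i j l u (Suc v) s \<and> fst s ''v'' 0 0 = v) s"
proof -
  define \<delta> where "\<delta> = min (excess s u) (payoff s u v)"
  have s_u: "fst s ''u'' 0 0 = u" using inv unfolding push_inv_def vars_def by simp
  define R where "R = (\<lambda>s'. fst s' = fst s \<and> payoff s' = push (payoff s) u v \<delta> \<and>
      excess s' = push_excess (excess s) u v \<delta>)"
  have R: "push_inv K i j l u (Suc v) s' \<and> fst s' ''v'' 0 0 = v"
    if "R s'" and adm: "label s u = Suc (label s v)" and pos: "0 < excess s u" for s'
  proof -
    have inv': "payoff_inv (payoff s) (excess s)" "label_inv (payoff s) (excess s) (label s)"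
      "progress K l u (excess s) (label s)" "label s u + l = n"
      using inv unfolding push_inv_def main_inv_def by auto
    have uv: "u \<noteq> v" using adm by auto
    have \<delta>: "0 \<le> \<delta>" "\<delta> \<le> payoff s u v" "\<delta> \<le> excess s u" "\<delta> = excess s u \<or> \<delta> = payoff s u v"
      using inv' u v pos unfolding \<delta>_def payoff_inv_def by auto
    note * = push_payoff_inv[OF inv'(1) u v(2) uv \<delta>(1,2)]
      push_label_inv[OF inv'(2) u v(2) adm \<delta>(1,3)]
      push_progress[OF inv'(3) u inv'(4) adm \<delta>(1) pos]
    \<comment> \<open>As \<delta> is the smaller of two amounts, the push uses up the excess of
      \<open>u\<close> or saturates the arc to \<open>v\<close>. Payoffs of \<open>u\<close> from
      earlier \<open>v'\<close> are untouched.\<close>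
    have "push_excess (excess s) u v \<delta> u \<le> 0 \<or> push (payoff s) u v \<delta> u v' \<le> 0"
      if "v' < Suc v" "label s u = Suc (label s v')" for v'
    proof (cases "v' = v")
      case True
      then show ?thesis using uv \<delta>(4) by (auto simp: push_excess_def push_def)
    next
      case False
      then have "payoff s u v' \<le> 0" using that inv pos unfolding push_inv_def by force
      then show ?thesis using uv False by (auto simp: push_def)
    qed
    moreover have "snd s' ''excess'' k 0 = push_excess (excess s) u v \<delta> k" for k
      using \<open>R s'\<close> unfolding R_def by metis
    ultimately show ?thesis
      using * inv \<open>R s'\<close> v unfolding R_def push_inv_def main_inv_def vars_def by simp
  qed
  have "wp push_prog (Suc (1 + (Suc (1 + 1) + (1 + (1 + (1 + 1)))) + 1))
      (\<lambda>s. push_inv K i j l u (Suc v) s \<and> fst s ''v'' 0 0 = v) s"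
    unfolding push_prog_def
  proof (intro wp_Cond)
    assume "holds (Conj (IEq (label_of ''u'') (IAdd (label_of ''v'') (IConst 1)))
         (RLess (RConst 0) (R1 ''excess'' ''u''))) s"
    then have *: "label s u = Suc (label s v)" "0 < excess s u" using s_u v by auto
    then have "u \<noteq> v" by auto
    show "wp (Seq (RSet ''delta'' (IConst 0) (IConst 0) (R1 ''excess'' ''u''))
       (Seq (Cond (RLess (R2 ''payoff'' ''u'' ''v'') (R0 ''delta''))
              (RSet ''delta'' (IConst 0) (IConst 0) (R2 ''payoff'' ''u'' ''v'')) Skip)
       (Seq (RSet ''payoff'' (IVar ''u'') (IVar ''v'') (RSub (R2 ''payoff'' ''u'' ''v'') (R0 ''delta'')))
       (Seq (RSet ''payoff'' (IVar ''v'') (IVar ''u'') (RAdd (R2 ''payoff'' ''v'' ''u'') (R0 ''delta'')))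
       (Seq (RSet ''excess'' (IVar ''u'') (IConst 0) (RSub (R1 ''excess'' ''u'') (R0 ''delta'')))
         (RSet ''excess'' (IVar ''v'') (IConst 0) (RAdd (R1 ''excess'' ''v'') (R0 ''delta''))))))))
         (1 + (Suc (1 + 1) + (1 + (1 + (1 + 1)))))
         (\<lambda>s. push_inv K i j l u (Suc v) s \<and> fst s ''v'' 0 0 = v) s"
      by (rule wp_mono[where Q = R, OF _ R[OF _ *]],
          intro wp_Seq wp_Cond wp_RSet wp_Skip;
          use s_u v \<open>u \<noteq> v\<close> in \<open>auto simp: R_def store_update_def push_def push_excess_def \<delta>_def fun_eq_iff\<close>)
  next
    assume "\<not> holds (Conj (IEq (label_of ''u'') (IAdd (label_of ''v'') (IConst 1)))
         (RLess (RConst 0) (R1 ''excess'' ''u''))) s"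
    then have "label s u \<noteq> Suc (label s v) \<or> excess s u \<le> 0" using s_u v by auto
    then show "wp Skip 1 (\<lambda>s. push_inv K i j l u (Suc v) s \<and> fst s ''v'' 0 0 = v) s"
      using inv v by (intro wp_Skip) (auto simp: push_inv_def less_Suc_eq)
  qed
  then show ?thesis by (simp add: eval_nat_numeral)
qed

text \<open>The cell of \<open>u\<close> is left open: this is the invariant of the loop counting in
  it, and \<open>wp_For\<close> lets that cell change freely.\<close>

definition vertex_inv :: "nat \<Rightarrow> nat \<Rightarrow> nat \<Rightarrow> nat \<Rightarrow> nat \<Rightarrow> state \<Rightarrow> bool" where
  "vertex_inv K i j l u s \<longleftrightarrow> main_inv s \<and> fst s ''i'' 0 0 = i \<and> fst s ''j'' 0 0 = j \<and> fst s ''l'' 0 0 = l \<and>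
     progress K l u (excess s) (label s)"

lemma wp_relabel_prog:
  assumes inv: "push_inv K i j l u n s" and u: "u < n"
  shows "wp relabel_prog 3 (\<lambda>s. vertex_inv K i j l (Suc u) s \<and> fst s ''u'' 0 0 = u) s"
proof -
  have s_u: "fst s ''u'' 0 0 = u" using inv unfolding push_inv_def vars_def by simp
  have inv': "payoff_inv (payoff s) (excess s)" "label_inv (payoff s) (excess s) (label s)"
      "progress K l u (excess s) (label s)"
    using inv unfolding push_inv_def main_inv_def by auto
  have "wp relabel_prog (Suc (1 + 1)) (\<lambda>s. vertex_inv K i j l (Suc u) s \<and> fst s ''u'' 0 0 = u) s"
    unfolding relabel_prog_def
  proof (intro wp_Cond wp_ISet wp_Skip)
    assume "holds (RLess (RConst 0) (R1 ''excess'' ''u'')) s"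
    then have pos: "0 < excess s u" using s_u by simp
    have sat: "payoff s u v \<le> 0" if "v < n" "label s u = Suc (label s v)" for v
      using that inv pos unfolding push_inv_def by force
    let ?s = "(store_update (fst s) ''label'' (ival (IVar ''u'') s) (ival (IConst 0) s)
             (ival (IAdd (label_of ''u'') (IConst 1)) s), snd s)"
    have "label ?s = (label s)(u := Suc (label s u))"
      using s_u by (auto simp: store_update_def)
    then show "vertex_inv K i j l (Suc u) ?s \<and> fst ?s ''u'' 0 0 = u"
      using inv relabel[OF inv'(1,2) u pos sat inv'(3)]
      unfolding vertex_inv_def push_inv_def main_inv_def vars_def
      by (simp add: store_update_def)
  next
    assume "\<not> holds (RLess (RConst 0) (R1 ''excess'' ''u'')) s"
    then have "excess s u \<le> 0" using s_u by simp
    then show "vertex_inv K i j l (Suc u) s \<and> fst s ''u'' 0 0 = u"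
      using inv progress_next_vertex[OF inv'(3)]
      unfolding vertex_inv_def push_inv_def vars_def by simp
  qed
  then show ?thesis by (simp add: eval_nat_numeral)
qed

lemma store_update_other: "c \<noteq> a \<Longrightarrow> store_update m a i j v c = m c"
  by (simp add: store_update_def)

lemma loop_invs_bound:
  "main_inv s \<Longrightarrow> fst s ''n'' 0 0 = n"
  "push_inv K i j l u v s \<Longrightarrow> fst s ''n'' 0 0 = n"
  "vertex_inv K i j l u s \<Longrightarrow> fst s ''n'' 0 0 = n"
  unfolding push_inv_def vertex_inv_def main_inv_def by auto

lemma loop_invs_frame:
  "push_inv K i j l u v (set_var ''v'' k s) = push_inv K i j l u v s"
  "vertex_inv K i j l u (set_var ''u'' k s) = vertex_inv K i j l u s"
  "a \<in> {''l'', ''j'', ''i''} \<Longrightarrow> main_inv (set_var a k s) = main_inv s"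
  unfolding push_inv_def vertex_inv_def main_inv_def vars_def store_update_def by auto

lemma wp_vertex_prog:
  assumes inv: "vertex_inv K i j l u s" and u: "fst s ''u'' 0 0 = u" "u < n"
  shows "wp vertex_prog (12 * n + 7) (\<lambda>s. vertex_inv K i j l (Suc u) s \<and> fst s ''u'' 0 0 = u) s"
proof -
  have s_n: "fst s ''n'' 0 0 = n" "fst s ''l'' 0 0 = l"
    using inv unfolding vertex_inv_def main_inv_def by auto
  have "wp vertex_prog (Suc (((n * (10 + 2) + 2) + 3) + 1))
      (\<lambda>s. vertex_inv K i j l (Suc u) s \<and> fst s ''u'' 0 0 = u) s"
    unfolding vertex_prog_def
  proof (intro wp_Cond wp_Seq wp_Skip)
    assume "holds (IEq (IAdd (label_of ''u'') (IVar ''l'')) (IVar ''n'')) s"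
    then have lev: "label s u + l = n" using u s_n by simp
    show "wp (For ''v'' (IVar ''n'') push_prog) (n * (10 + 2) + 2)
      (wp relabel_prog 3 (\<lambda>s. vertex_inv K i j l (Suc u) s \<and> fst s ''u'' 0 0 = u)) s"
    proof (rule wp_mono[OF wp_For[where I = "push_inv K i j l u"]])
      show "push_inv K i j l u 0 s"
        using inv u lev unfolding push_inv_def vertex_inv_def vars_def by simp
    qed (use u(2) in \<open>simp_all add: loop_invs_bound loop_invs_frame wp_push_prog wp_relabel_prog\<close>)
  next
    assume "\<not> holds (IEq (IAdd (label_of ''u'') (IVar ''l'')) (IVar ''n'')) s"
    then have "label s u + l \<noteq> n" using u s_n by auto
    then show "vertex_inv K i j l (Suc u) s \<and> fst s ''u'' 0 0 = u"
      using inv u progress_next_vertex unfolding vertex_inv_def by simp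
  qed
  then show ?thesis by (simp add: algebra_simps)
qed

definition pass_time :: nat where
  "pass_time = Suc n * (n * (12 * n + 7 + 2) + 2 + 2) + 2"

definition pass_inv :: "nat \<Rightarrow> nat \<Rightarrow> state \<Rightarrow> bool" where
  "pass_inv K i s \<longleftrightarrow> main_inv s \<and> fst s ''i'' 0 0 = i \<and> settled K (excess s) (label s)"

lemma wp_pass_prog:
  assumes inv: "pass_inv K i s" and j: "fst s ''j'' 0 0 = j"
  shows "wp pass_prog pass_time (\<lambda>s. pass_inv (Suc K) i s \<and> fst s ''j'' 0 0 = j) s"
  unfolding pass_prog_def pass_time_def
proof (rule wp_mono[OF wp_For[where I = "\<lambda>l s. main_inv s \<and> fst s ''i'' 0 0 = i \<and>
     fst s ''j'' 0 0 = j \<and> progress K l 0 (excess s) (label s)"]])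
  fix l s
  assume *: "main_inv s \<and> fst s ''i'' 0 0 = i \<and>
     fst s ''j'' 0 0 = j \<and> progress K l 0 (excess s) (label s)" "fst s ''l'' 0 0 = l"
  show "wp (For ''u'' (IVar ''n'') vertex_prog) (n * (12 * n + 7 + 2) + 2)
     (\<lambda>s. (main_inv s \<and> fst s ''i'' 0 0 = i \<and>
     fst s ''j'' 0 0 = j \<and> progress K (Suc l) 0 (excess s) (label s)) \<and> fst s ''l'' 0 0 = l) s"
  proof (rule wp_mono[OF wp_For[where I = "vertex_inv K i j l"]])
    show "vertex_inv K i j l 0 s" using * by (simp add: vertex_inv_def)
    show "(main_inv s \<and> fst s ''i'' 0 0 = i \<and> fst s ''j'' 0 0 = j \<and>
        progress K (Suc l) 0 (excess s) (label s)) \<and> fst s ''l'' 0 0 = l"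
      if "vertex_inv K i j l n s" for s
      using that progress_next_level by (simp add: vertex_inv_def)
  qed (simp_all add: loop_invs_bound loop_invs_frame wp_vertex_prog)
next
  show "main_inv s \<and> fst s ''i'' 0 0 = i \<and>
     fst s ''j'' 0 0 = j \<and> progress K 0 0 (excess s) (label s)"
    using inv j progress_start unfolding pass_inv_def main_inv_def by blast
qed (auto simp: pass_inv_def loop_invs_bound loop_invs_frame store_update_other dest: progress_end)

lemma wp_main_prog:
  assumes "main_inv s" "settled 0 (excess s) (label s)"
  shows "wp main_prog (Suc n * (n * (pass_time + 2) + 2 + 2) + 2)
    (\<lambda>s. main_inv s \<and> settled (Suc n * n) (excess s) (label s)) s"
  unfolding main_prog_def
proof (rule wp_For[where I = "\<lambda>i s. main_inv s \<and> settled (i * n) (excess s) (label s)"])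
  fix i s
  assume *: "main_inv s \<and> settled (i * n) (excess s) (label s)" "fst s ''i'' 0 0 = i"
  show "wp (For ''j'' (IVar ''n'') pass_prog) (n * (pass_time + 2) + 2)
     (\<lambda>s. (main_inv s \<and> settled (Suc i * n) (excess s) (label s)) \<and> fst s ''i'' 0 0 = i) s"
  \<comment> \<open>Before step \<open>j\<close> of round \<open>i\<close>, the number of completed
    passes is \<open>i * n + j\<close>.\<close>
  proof (rule wp_mono[OF wp_For[where I = "\<lambda>j. pass_inv (i * n + j) i"]])
    show "pass_inv (i * n + 0) i s" using * by (simp add: pass_inv_def)
    show "(main_inv s \<and> settled (Suc i * n) (excess s) (label s)) \<and> fst s ''i'' 0 0 = i"
      if "pass_inv (i * n + n) i s" for s
      using that by (simp add: pass_inv_def add.commute)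
    show "pass_inv (i * n + j) i (set_var ''j'' k s)" if "pass_inv (i * n + j) i s" for j k s
      using that by (simp add: pass_inv_def main_inv_def store_update_def)
  qed (simp_all add: wp_pass_prog, simp add: pass_inv_def loop_invs_bound)
qed (use assms in \<open>simp_all add: loop_invs_bound loop_invs_frame store_update_other\<close>)

section \<open>Initialisation of payoffs and excesses\<close>

definition input :: "state \<Rightarrow> bool" where
  "input s \<longleftrightarrow> fst s ''n'' 0 0 = n \<and>
     (\<forall>i<n. \<forall>j<n. W i j = (if 0 < fst s ''matching'' i j then snd s ''weight'' i j else 0)) \<and>
     (\<forall>i<n. snd s ''allocation'' i 0 = x i) \<and> (\<forall>i. label s i = 0)"

text \<open>Entries are filled in lexicographic order up to \<open>(u, v)\<close>; the excess of the
  unfinished row \<open>u\<close> is left to the loop over \<open>v\<close>. The conjunct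
  \<open>input\<close> survives because it concerns only cells that initialisation never
  writes.\<close>

definition init_inv :: "nat \<Rightarrow> nat \<Rightarrow> state \<Rightarrow> bool" where
  "init_inv u v s \<longleftrightarrow> input s \<and>
     (\<forall>i<n. \<forall>j<n. payoff s i j = (if i < u \<or> i = u \<and> j < v then initial_payoff i j else 0)) \<and>
     (\<forall>i<u. excess s i = (\<Sum>j<n. initial_payoff i j) - x i)"

lemma wp_init_entry:
  assumes "init_inv u v s" "excess s u = (\<Sum>j<v. initial_payoff u j) - x u"
    and "fst s ''u'' 0 0 = u" "fst s ''v'' 0 0 = v" "u < n" "v < n"
  shows "wp init_entry 4 (\<lambda>s. (init_inv u (Suc v) s \<and>
     excess s u = (\<Sum>j<Suc v. initial_payoff u j) - x u \<and> fst s ''u'' 0 0 = u) \<and> fst s ''v'' 0 0 = v) s"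
proof -
  have "wp init_entry (Suc ((1 + 1) + 1)) (\<lambda>s. (init_inv u (Suc v) s \<and>
     excess s u = (\<Sum>j<Suc v. initial_payoff u j) - x u \<and> fst s ''u'' 0 0 = u) \<and> fst s ''v'' 0 0 = v) s"
    unfolding init_entry_def
    \<comment> \<open>In the \<open>Skip\<close> branch \<open>v \<le> u\<close> or the pair is
      unmatched, so \<open>initial_payoff u v\<close> is 0 and the partial sum is already
      right.\<close>
    by (intro wp_Cond wp_Seq wp_RSet wp_Skip;
        use assms in \<open>auto simp: init_inv_def input_def initial_payoff_def store_update_def less_Suc_eq\<close>)
  then show ?thesis by (simp add: eval_nat_numeral)
qed

lemma init_inv_bound: "init_inv u v s \<Longrightarrow> fst s ''n'' 0 0 = n"
  unfolding init_inv_def input_def by simp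

lemma init_inv_frame: "c \<in> {''u'', ''v''} \<Longrightarrow> init_inv u v (set_var c k s) = init_inv u v s"
  unfolding init_inv_def input_def store_update_def by auto

lemma init_inv_next:
  assumes "init_inv u n s" "excess s u = (\<Sum>j<n. initial_payoff u j) - x u"
  shows "init_inv (Suc u) 0 s"
  using assms unfolding init_inv_def by (simp add: less_Suc_eq)

lemma wp_init_prog:
  assumes "input s" "\<And>i j. payoff s i j = 0"
  shows "wp init_prog (n * (1 + (n * (4 + 2) + 2) + 2) + 2)
    (\<lambda>s. main_inv s \<and> settled 0 (excess s) (label s)) s"
  unfolding init_prog_def
proof (rule wp_mono[OF wp_For[where I = "\<lambda>u. init_inv u 0"]])
  fix u s
  assume *: "u < n" "init_inv u 0 s" "fst s ''u'' 0 0 = u"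
  show "wp (Seq (RSet ''excess'' (IVar ''u'') (IConst 0) (RSub (RConst 0) (R1 ''allocation'' ''u'')))
       (For ''v'' (IVar ''n'') init_entry)) (1 + (n * (4 + 2) + 2))
     (\<lambda>s. init_inv (Suc u) 0 s \<and> fst s ''u'' 0 0 = u) s"
  proof (intro wp_Seq wp_RSet, rule wp_mono[OF wp_For[where I = "\<lambda>v s. init_inv u v s \<and>
           excess s u = (\<Sum>j<v. initial_payoff u j) - x u \<and> fst s ''u'' 0 0 = u"]])
    let ?s = "(fst s, store_update (snd s) ''excess'' (ival (IVar ''u'') s) (ival (IConst 0) s)
      (rval (RSub (RConst 0) (R1 ''allocation'' ''u'')) s))"
    show "init_inv u 0 ?s \<and> excess ?s u = (\<Sum>j<0. initial_payoff u j) - x u \<and> fst ?s ''u'' 0 0 = u"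
      using * by (simp add: init_inv_def input_def store_update_def)
    show "init_inv (Suc u) 0 s \<and> fst s ''u'' 0 0 = u"
      if "init_inv u n s \<and> excess s u = (\<Sum>j<n. initial_payoff u j) - x u \<and> fst s ''u'' 0 0 = u" for s
      using that init_inv_next by blast
    show "wp init_entry 4 (\<lambda>s. (init_inv u (Suc v) s \<and>
        excess s u = (\<Sum>j<Suc v. initial_payoff u j) - x u \<and> fst s ''u'' 0 0 = u) \<and> fst s ''v'' 0 0 = v) s"
      if "v < n" "init_inv u v s \<and> excess s u = (\<Sum>j<v. initial_payoff u j) - x u \<and> fst s ''u'' 0 0 = u"
        "fst s ''v'' 0 0 = v" for v s
      using that *(1) by (intro wp_init_entry) auto
    show "ival (IVar ''n'') s = n"
      if "init_inv u v s \<and> excess s u = (\<Sum>j<v. initial_payoff u j) - x u \<and> fst s ''u'' 0 0 = u" for v s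
      using init_inv_bound[OF conjunct1[OF that]] by simp
  qed (simp add: init_inv_frame store_update_other)
next
  fix s assume "init_inv n 0 s"
  then show "main_inv s \<and> settled 0 (excess s) (label s)"
    using initial_inv[of "payoff s" "excess s" "label s"]
    by (simp add: init_inv_def input_def main_inv_def)
next
  show "init_inv 0 0 s" using assms by (simp add: init_inv_def)
qed (simp_all add: init_inv_bound init_inv_frame)

lemma wp_Seq_init_main:
  assumes "input s" "\<And>i j. payoff s i j = 0"
  shows "wp (Seq init_prog main_prog)
    ((n * (1 + (n * (4 + 2) + 2) + 2) + 2) + (Suc n * (n * (pass_time + 2) + 2 + 2) + 2))
    (\<lambda>s. payoff_inv (payoff s) (\<lambda>_. 0)) s"
proof (rule wp_mono)
  show "wp (Seq init_prog main_prog)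
    ((n * (1 + (n * (4 + 2) + 2) + 2) + 2) + (Suc n * (n * (pass_time + 2) + 2 + 2) + 2))
    (\<lambda>s. main_inv s \<and> settled (Suc n * n) (excess s) (label s)) s"
    by (rule wp_Seq, rule wp_mono[OF wp_init_prog[OF assms]], rule wp_main_prog) auto
next
  fix s assume s: "main_inv s \<and> settled (Suc n * n) (excess s) (label s)"
  then have "\<forall>i<n. excess s i = 0" using excess_eq_0 unfolding main_inv_def by blast
  then show "payoff_inv (payoff s) (\<lambda>_. 0)"
    using s unfolding main_inv_def payoff_inv_def by simp
qed

end

section \<open>From core allocations to transport\<close>

text \<open>Double counting: an edge is met once from each of its two ends, and no singleton
  \<open>{i, i}\<close> lies in \<open>F\<close>.\<close>

lemma sum_incident_pairs:
  fixes w :: "'a set \<Rightarrow> real"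
  assumes "finite A" and F: "\<And>e. e \<in> F \<Longrightarrow> e \<subseteq> A \<and> card e = 2"
  shows "(\<Sum>i\<in>A. \<Sum>j\<in>A. if {i, j} \<in> F then w {i, j} else 0) = 2 * weight w F"
proof -
  have fin: "finite F"
    using F \<open>finite A\<close> by (intro finite_subset[of F "Pow A"]) auto
  have "(\<Sum>j\<in>A. if {i, j} \<in> F then w {i, j} else 0) = (\<Sum>e\<in>F. if i \<in> e then w e else 0)"
    if "i \<in> A" for i
  proof -
    \<comment> \<open>An edge at \<open>i\<close> is determined by its other end, so the inner sum
      becomes one over incident edges.\<close>
    have "bij_betw (\<lambda>j. {i, j}) {j\<in>A. {i, j} \<in> F} {e\<in>F. i \<in> e}"
    proof (rule bij_betw_imageI)
      show "inj_on (\<lambda>j. {i, j}) {j\<in>A. {i, j} \<in> F}"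
        by (auto simp: inj_on_def doubleton_eq_iff)
      show "(\<lambda>j. {i, j}) ` {j\<in>A. {i, j} \<in> F} = {e\<in>F. i \<in> e}"
      proof (intro equalityI subsetI)
        fix e assume e: "e \<in> {e\<in>F. i \<in> e}"
        then have "card e = 2" using F by auto
        then obtain a b where "e = {a, b}" by (auto simp: card_2_iff)
        with e obtain j where "e = {i, j}" by auto
        with e F show "e \<in> (\<lambda>j. {i, j}) ` {j\<in>A. {i, j} \<in> F}" by blast
      qed auto
    qed
    from sum.reindex_bij_betw[OF this, of w] show ?thesis
      using \<open>finite A\<close> fin by (simp add: sum.inter_filter)
  qed
  then have "(\<Sum>i\<in>A. \<Sum>j\<in>A. if {i, j} \<in> F then w {i, j} else 0) =
      (\<Sum>e\<in>F. \<Sum>i\<in>A. if i \<in> e then w e else 0)"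
    by (simp add: sum.swap[of _ F])
  also have "\<dots> = (\<Sum>e\<in>F. 2 * w e)"
  proof (intro sum.cong refl)
    fix e assume "e \<in> F"
    with F have "A \<inter> e = e" "card e = 2" by auto
    then show "(\<Sum>i\<in>A. if i \<in> e then w e else 0) = 2 * w e"
      using \<open>finite A\<close> by (simp add: sum.If_cases Collect_mem_eq)
  qed
  finally show ?thesis by (simp add: weight_def sum_distrib_left)
qed

section \<open>Core inequalities for the edges of the matching\<close>

context
  fixes N :: "'a set" and E b w M x
  assumes graph: "weighted_graph N E w" and M: "max_weight_b_matching N E b w M"
    and core: "core_allocation N (game_value E b w) x"
begin

lemma finite_edges: "finite E"
  using graph unfolding weighted_graph_def by (intro finite_subset[of E "Pow N"]) auto

lemma finite_matching_weights: "finite {weight w M' |M'. b_matching S (induced_edges E S) b M'}"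
proof (rule finite_subset)
  show "{weight w M' |M'. b_matching S (induced_edges E S) b M'} \<subseteq> weight w ` Pow E"
    by (auto simp: b_matching_def induced_edges_def)
qed (simp add: finite_edges)

lemma matching_weight_le_core:
  assumes S: "S \<subseteq> N"
  shows "weight w {e\<in>M. e \<subseteq> S} \<le> sum x S"
\<comment> \<open>The core constrains only nonempty coalitions; inside the empty one there is no
  edge.\<close>
proof (cases "S = {}")
  case True
  have "{e\<in>M. e \<subseteq> S} = {}"
    using M graph True
    unfolding max_weight_b_matching_def b_matching_def weighted_graph_def by force
  then show ?thesis using True by (simp only: weight_def sum.empty image_empty)
next
  case False
  have MN: "M \<subseteq> E" "\<forall>i\<in>N. card {e\<in>M. i \<in> e} \<le> b i"
    using M unfolding max_weight_b_matching_def b_matching_def by auto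
  have "card {e\<in>{e\<in>M. e \<subseteq> S}. i \<in> e} \<le> b i" if "i \<in> S" for i
  proof -
    have "card {e\<in>{e\<in>M. e \<subseteq> S}. i \<in> e} \<le> card {e\<in>M. i \<in> e}"
      using MN finite_edges by (intro card_mono) (auto intro: finite_subset)
    then show ?thesis using MN S that by force
  qed
  then have "b_matching S (induced_edges E S) b {e\<in>M. e \<subseteq> S}"
    using MN by (auto simp: b_matching_def induced_edges_def)
  then have "weight w {e\<in>M. e \<subseteq> S} \<le> game_value E b w S"
    unfolding game_value_def using finite_matching_weights by (intro Max_ge) auto
  also have "\<dots> \<le> sum x S"
    using core S False unfolding core_allocation_def by blast
  finally show ?thesis .
qed

text \<open>Efficiency of \<open>x\<close> gives the value of the grand coalition, which is at most
  the weight of \<open>M\<close> by maximality.\<close>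

lemma core_le_matching_weight: "sum x N \<le> weight w M"
proof -
  have E: "induced_edges E N = E"
    using graph unfolding weighted_graph_def induced_edges_def by auto
  have "b_matching N (induced_edges E N) b M"
    using M E unfolding max_weight_b_matching_def by simp
  then have "game_value E b w N \<le> weight w M"
    unfolding game_value_def using M E
    by (subst Max_le_iff[OF finite_matching_weights]) (auto simp: max_weight_b_matching_def)
  with core show ?thesis unfolding core_allocation_def by simp
qed

lemma transport_core:
  assumes vs: "distinct vs" "set vs = N"
  shows "transport (length vs) (\<lambda>i j. if {vs ! i, vs ! j} \<in> M then w {vs ! i, vs ! j} else 0)
    (\<lambda>i. x (vs ! i))" (is "transport ?n ?W ?x")
proof
  have ME: "M \<subseteq> E" using M unfolding max_weight_b_matching_def b_matching_def by simp
  have edge: "e \<subseteq> N \<and> card e = 2 \<and> 0 \<le> w e" if "e \<in> M" for e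
    using that ME graph unfolding weighted_graph_def by auto
  show "0 \<le> ?W i j" for i j using edge by auto
  show "?W i j = ?W j i" for i j by (simp add: insert_commute)
  show "?W i i = 0" for i using edge[of "{vs ! i}"] by auto
  have inj: "inj_on ((!) vs) S" if "S \<subseteq> {..<?n}" for S
    using that vs(1) by (meson inj_on_nth lessThan_iff subsetD)
  have weight: "(\<Sum>i\<in>S. \<Sum>j\<in>S. ?W i j) = 2 * weight w {e\<in>M. e \<subseteq> (!) vs ` S}"
    and demand: "sum ?x S = sum x ((!) vs ` S)"
    if S: "S \<subseteq> {..<?n}" for S
  proof -
    have fin: "finite S" using S finite_subset by blast
    have "(\<Sum>i\<in>S. \<Sum>j\<in>S. ?W i j) = (\<Sum>i\<in>(!) vs ` S. \<Sum>j\<in>(!) vs ` S. if {i, j} \<in> M then w {i, j} else 0)"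
      using inj[OF S] by (simp add: sum.reindex)
    \<comment> \<open>Both ends range over the image of \<open>S\<close>, so restricting to edges
      inside it changes no term; \<open>sum_incident_pairs\<close> asks for such edges.\<close>
    also have "\<dots> = (\<Sum>i\<in>(!) vs ` S. \<Sum>j\<in>(!) vs ` S.
        if {i, j} \<in> {e\<in>M. e \<subseteq> (!) vs ` S} then w {i, j} else 0)"
      by (intro sum.cong refl) auto
    also have "\<dots> = 2 * weight w {e\<in>M. e \<subseteq> (!) vs ` S}"
      using fin edge by (intro sum_incident_pairs) auto
    finally show "(\<Sum>i\<in>S. \<Sum>j\<in>S. ?W i j) = 2 * weight w {e\<in>M. e \<subseteq> (!) vs ` S}" .
    show "sum ?x S = sum x ((!) vs ` S)"
      using inj[OF S] by (simp add: sum.reindex)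
  qed
  show "(\<Sum>i\<in>S. \<Sum>j\<in>S. ?W i j) \<le> 2 * sum ?x S" if S: "S \<subseteq> {..<?n}" for S
    using matching_weight_le_core[of "(!) vs ` S"] weight[OF S] demand[OF S] S vs by force
  have "(!) vs ` {..<?n} = N" using vs(2) by (auto simp: in_set_conv_nth)
  moreover have "{e\<in>M. e \<subseteq> N} = M" using edge by auto
  ultimately show "2 * sum ?x {..<?n} \<le> (\<Sum>i<?n. \<Sum>j<?n. ?W i j)"
    using weight[of "{..<?n}"] demand[of "{..<?n}"] core_le_matching_weight by simp
qed

end

theorem theorem10:
  "\<exists>(P :: com) (q :: nat poly).
     \<forall>(N :: 'a set) E b w M x vs.
       weighted_graph N E w \<longrightarrow>
       max_weight_b_matching N E b w M \<longrightarrow>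
       core_allocation N (game_value E b w) x \<longrightarrow>
       distinct vs \<and> set vs = N \<longrightarrow>
       (\<exists>p t s.
          exec P (input_state vs E b w M x) t s \<and>
          t \<le> poly q (card N) \<and>
          outputs_payoff vs s p \<and>
          compatible_payoff N w M p \<and>
          (\<forall>i\<in>N. x i = total_payoff N E p i))"
proof -
  define X :: "nat poly" where "X = [:0, 1:]"
  \<comment> \<open>The time bound of \<open>wp_Seq_init_main\<close> with \<open>pass_time\<close>
    unfolded and \<open>n\<close> read as the indeterminate; the degree is 5.\<close>
  define q where "q = X * (X * [:6:] + [:5:]) + [:2:] +
    ((X + 1) * (X * ((X + 1) * (X * (X * [:12:] + [:9:]) + [:4:]) + [:2:] + [:2:]) + [:4:]) + [:2:])"
  have "\<exists>p t s. exec (Seq init_prog main_prog) (input_state vs E b w M x) t s \<and>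
          t \<le> poly q (card N) \<and> outputs_payoff vs s p \<and> compatible_payoff N w M p \<and>
          (\<forall>i\<in>N. x i = total_payoff N E p i)"
    if graph: "weighted_graph N E w" and M: "max_weight_b_matching N E b w M"
      and core: "core_allocation N (game_value E b w) x" and vs: "distinct vs" "set vs = N"
    for N :: "'a set" and E b w M x vs
  proof -
    let ?n = "length vs" and ?s = "input_state vs E b w M x"
    let ?W = "\<lambda>i j. if {vs ! i, vs ! j} \<in> M then w {vs ! i, vs ! j} else 0"
    interpret transport ?n ?W "\<lambda>i. x (vs ! i)"
      using graph M core vs by (rule transport_core)
    have ME: "M \<subseteq> E" using M unfolding max_weight_b_matching_def b_matching_def by simp
    have "input ?s" using ME by (auto simp: input_def input_state_def)
    moreover have "payoff ?s i j = 0" for i j by (simp add: input_state_def)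
    ultimately obtain t s where t: "exec (Seq init_prog main_prog) ?s t s"
      "t \<le> (?n * (1 + (?n * (4 + 2) + 2) + 2) + 2) + (Suc ?n * (?n * (pass_time + 2) + 2 + 2) + 2)"
      and s: "payoff_inv (payoff s) (\<lambda>_. 0)"
      using wp_Seq_init_main unfolding wp_def by blast
    have card: "card N = ?n" using vs distinct_card by force
    have time: "t \<le> poly q (card N)"
      using t(2) unfolding card q_def X_def pass_time_def by (simp add: algebra_simps)
    \<comment> \<open>Distinctness of \<open>vs\<close> makes positions recoverable from vertices,
      so the output matrix becomes a function on vertices.\<close>
    define p where "p a c = payoff s (inv_into {..<?n} ((!) vs) a) (inv_into {..<?n} ((!) vs) c)" for a c
    have p: "p (vs ! k) (vs ! l) = payoff s k l" if "k < ?n" "l < ?n" for k l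
      using that vs(1) by (simp add: p_def inj_on_nth inv_into_f_f)
    have nth: "\<exists>k<?n. i = vs ! k" if "i \<in> N" for i
      using that vs(2) by (metis in_set_conv_nth)
    have p_sum: "0 \<le> p i j \<and> p i j + p j i = (if {i, j} \<in> M then w {i, j} else 0)"
      if ij: "i \<in> N" "j \<in> N" for i j
    proof -
      obtain k l where "k < ?n" "i = vs ! k" "l < ?n" "j = vs ! l" using nth ij by metis
      then show ?thesis using s p unfolding payoff_inv_def by auto
    qed
    \<comment> \<open>Two nonnegative payoffs with sum 0 both vanish.\<close>
    have p_zero: "p i j = 0" if "i \<in> N" "j \<in> N" "{i, j} \<notin> M" for i j
      using p_sum[OF that(1,2)] p_sum[OF that(2,1)] that(3) by auto
    have "compatible_payoff N w M p"
      unfolding compatible_payoff_def using p_sum p_zero by (metis insert_commute)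
    moreover have "x i = total_payoff N E p i" if "i \<in> N" for i
    proof -
      obtain k where k: "k < ?n" "i = vs ! k" using nth \<open>i \<in> N\<close> by blast
      have "bij_betw ((!) vs) {..<?n} N" using vs bij_betw_nth by blast
      then have "(\<Sum>j\<in>N. p i j) = (\<Sum>l<?n. p i (vs ! l))"
        by (rule sum.reindex_bij_betw[symmetric])
      also have "\<dots> = (\<Sum>l<?n. payoff s k l)"
        using k p by simp
      also have "\<dots> = x i" using s k unfolding payoff_inv_def by simp
      finally have "(\<Sum>j\<in>N. p i j) = x i" .
      \<comment> \<open>\<open>total_payoff\<close> sums over neighbours only; as
        \<open>M \<subseteq> E\<close>, the remaining vertices contribute zeros.\<close>
      moreover have "total_payoff N E p i = (\<Sum>j\<in>N. p i j)"
        unfolding total_payoff_def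
        using p_zero[OF \<open>i \<in> N\<close>] ME graph
        by (intro sum.mono_neutral_left) (auto simp: weighted_graph_def)
      ultimately show ?thesis by simp
    qed
    moreover have "outputs_payoff vs s p" using p by (simp add: outputs_payoff_def)
    ultimately show ?thesis using t(1) time by blast
  qed
  then show ?thesis by blast
qed

end
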